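(* Let $n$ be a positive integer. Then every integer in the set $\{0,1,\ldots,n\}\setminus\{\lfloor n/2\rfloor\}$ is an eigenvalue of the adjacency matrix of the burnt pancake graph $\mathbb{BP}_n$.
   Context: For a positive integer $n$, let $\pm[n]=\{-n,\ldots,-1,1,\ldots,n\}$ and let $B_n$ be the hyperoctahedral group of all bijections $\sigma:\pm[n]\to\pm[n]$ satisfying $\sigma(-i)=-\sigma(i)$ for $1\le i\le n$ (so $|B_n|=2^n n!$). An element $\sigma\in B_n$ is written in one-line notation $\sigma=\sigma_1\sigma_2\cdots\sigma_n$ with $\sigma_i=\sigma(i)$; a bar denotes a negative sign, $\overline{a}=-a$. For $1\le i\le n$ the $i$-th signed prefix reversal $r_i:B_n\to B_n$ is defined by $$r_i(\sigma_1\cdots\sigma_n)=\overline{\sigma_i}\,\overline{\sigma_{i-1}}\cdots\overline{\sigma_1}\,\sigma_{i+1}\cdots\sigma_n .$$ The burnt pancake graph $\mathbb{BP}_n$ is the (undirected, simple, $n$-regular) graph with vertex set $B_n$ in which $\sigma$ and $r_i(\sigma)$ are adjacent for every $\sigma\in B_n$ and $1\le i\le n$. *)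

theory Defs
  imports "HOL-Combinatorics.Permutations" "Jordan_Normal_Form.Char_Poly"
begin

definition pm_interval :: "nat \<Rightarrow> int set" where
  "pm_interval n = {- int n..-1} \<union> {1..int n}"

text \<open>Signed permutations are total functions on the integers which, by
  \<^const>\<open>permutes\<close>, are the identity outside \<^const>\<open>pm_interval\<close>.\<close>

definition hyperoctahedral :: "nat \<Rightarrow> (int \<Rightarrow> int) set" where
  "hyperoctahedral n =
     {\<sigma>. \<sigma> permutes pm_interval n \<and> (\<forall>i\<in>{1..int n}. \<sigma> (- i) = - \<sigma> i)}"

text \<open>The second branch is forced by oddness: the value at \<open>j < 0\<close> is minus the value at \<open>- j\<close>.\<close>

definition prefix_reversal :: "nat \<Rightarrow> (int \<Rightarrow> int) \<Rightarrow> int \<Rightarrow> int" where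
  "prefix_reversal i \<sigma> = (\<lambda>j.
     if j \<in> {1..int i} then - \<sigma> (int i + 1 - j)
     else if j \<in> {- int i..-1} then \<sigma> (int i + 1 + j)
     else \<sigma> j)"

definition burnt_pancake_edges :: "nat \<Rightarrow> (int \<Rightarrow> int) set set" where
  "burnt_pancake_edges n =
     {{\<sigma>, prefix_reversal i \<sigma>} | \<sigma> i. \<sigma> \<in> hyperoctahedral n \<and> i \<in> {1..n}}"

text \<open>Rows and columns follow an enumeration \<open>vs\<close> of the vertex set.\<close>

definition adjacency_matrix :: "'a list \<Rightarrow> 'a set set \<Rightarrow> real mat" where
  "adjacency_matrix vs E =
     mat (length vs) (length vs) (\<lambda>(i, j). if {vs ! i, vs ! j} \<in> E then 1 else 0)"

lemma finite_hyperoctahedral: "finite (hyperoctahedral n)"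
proof -
  have "finite {\<sigma>. \<sigma> permutes pm_interval n}"
    by (rule finite_permutations) (simp add: pm_interval_def)
  then show ?thesis
    by (rule rev_finite_subset) (auto simp: hyperoctahedral_def)
qed

lemma hyperoctahedral_odd:
  assumes "\<sigma> \<in> hyperoctahedral n"
  shows "\<sigma> (- j) = - \<sigma> j"
proof -
  have p: "\<sigma> permutes pm_interval n" and o: "\<And>i. i \<in> {1..int n} \<Longrightarrow> \<sigma> (- i) = - \<sigma> i"
    using assms by (auto simp: hyperoctahedral_def)
  consider "j \<in> {1..int n}" | "- j \<in> {1..int n}" | "j \<notin> pm_interval n" "- j \<notin> pm_interval n"
    unfolding pm_interval_def Un_iff atLeastAtMost_iff by linarith
  then show ?thesis
    using o[of j] o[of "- j"] permutes_not_in[OF p] by cases auto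
qed

lemma prefix_reversal_involution:
  assumes "\<sigma> \<in> hyperoctahedral n"
  shows "prefix_reversal i (prefix_reversal i \<sigma>) = \<sigma>"
proof
  fix j
  show "prefix_reversal i (prefix_reversal i \<sigma>) j = \<sigma> j"
    using hyperoctahedral_odd[OF assms, of j]
    by (simp add: prefix_reversal_def)
qed

lemma prefix_reversal_closed:
  assumes s: "\<sigma> \<in> hyperoctahedral n" and i: "i \<in> {1..n}"
  shows "prefix_reversal i \<sigma> \<in> hyperoctahedral n"
proof -
  let ?r = "prefix_reversal i \<sigma>"
  have p: "\<sigma> permutes pm_interval n" using s by (simp add: hyperoctahedral_def)
  define \<rho> where "\<rho> = prefix_reversal i (\<lambda>j. j)"
  have \<rho>: "\<rho> j = (if 1 \<le> j \<and> j \<le> int i then j - int i - 1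
      else if - int i \<le> j \<and> j \<le> -1 then int i + 1 + j else j)" for j
    unfolding \<rho>_def prefix_reversal_def atLeastAtMost_iff by (simp only: minus_diff_eq diff_diff_eq)
  have inv: "\<rho> (\<rho> j) = j" for j
    unfolding \<rho> by (smt (verit))
  have closed: "\<rho> j \<in> pm_interval n" if "j \<in> pm_interval n" for j
  proof -
    have "int i \<le> int n" using i by simp
    then show ?thesis
      using that unfolding \<rho> pm_interval_def Un_iff atLeastAtMost_iff by (smt (verit))
  qed
  have "bij_betw \<rho> (pm_interval n) (pm_interval n)"
    by (rule bij_betw_byWitness[where f' = \<rho>]) (use inv closed in blast)+
  moreover have "\<rho> j = j" if "j \<notin> pm_interval n" for j
  proof -
    have "int i \<le> int n" using i by simp
    then show ?thesis
      using that unfolding \<rho> pm_interval_def Un_iff atLeastAtMost_iff by (smt (verit))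
  qed
  ultimately have "\<rho> permutes pm_interval n" by (rule bij_imp_permutes)
  from permutes_compose[OF this p] have "\<sigma> \<circ> \<rho> permutes pm_interval n" .
  moreover have comp: "?r = \<sigma> \<circ> \<rho>"
  proof
    fix j
    have "\<sigma> (j - int i - 1) = - \<sigma> (int i + 1 - j)"
      using hyperoctahedral_odd[OF s, of "int i + 1 - j"] by (simp only: minus_diff_eq diff_diff_eq)
    then show "?r j = (\<sigma> \<circ> \<rho>) j"
      unfolding comp_def \<rho> prefix_reversal_def atLeastAtMost_iff by (simp only: if_distrib[of \<sigma>])
  qed
  moreover have "?r (- j) = - ?r j" for j
  proof -
    have "\<rho> (- j) = - \<rho> j" unfolding \<rho> by (smt (verit))
    then show ?thesis unfolding comp by (simp only: comp_def hyperoctahedral_odd[OF s])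
  qed
  ultimately show ?thesis by (simp add: hyperoctahedral_def)
qed

lemma prefix_reversal_neq:
  assumes s: "\<sigma> \<in> hyperoctahedral n" and i: "i \<in> {1..n}"
  shows "prefix_reversal i \<sigma> \<noteq> \<sigma>"
proof
  assume eq: "prefix_reversal i \<sigma> = \<sigma>"
  have "\<sigma> 1 = \<sigma> (- int i)"
    using fun_cong[OF eq, of 1] i hyperoctahedral_odd[OF s, of "int i"]
    by (simp add: prefix_reversal_def)
  moreover have "inj \<sigma>" using s permutes_inj by (auto simp: hyperoctahedral_def)
  ultimately have "1 = - int i" by (simp only: inj_eq)
  then show False by linarith
qed

end

theory Submission
  imports Defs
begin

text \<open>
  Fix a label \<open>c\<close> and lift functions \<open>g\<close> on positions to \<open>\<sigma> \<mapsto> g p\<close>, where \<open>p\<close> is the position with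
  \<open>\<bar>\<sigma> p\<bar> = c\<close>. The reversal \<open>r\<^sub>i\<close> moves \<open>p\<close> to \<open>i + 1 - p\<close> if \<open>p \<le> i\<close> and fixes it otherwise, so the
  adjacency operator acts on lifts by \<open>g \<mapsto> (\<lambda>p. (p - 1) g p + (g 1 + \<dots> + g (n + 1 - p)))\<close>.
  For the eigenvalue \<open>l\<close> take \<open>g\<close> to be \<open>1\<close> on an interval \<open>A\<close> and \<open>- \<bar>A\<bar>\<close> at \<open>l + 1\<close>, where
  \<open>A = {n - l + 1..l}\<close> or \<open>A = {l + 2..n - l}\<close>. Either choice makes the sum \<open>g 1 + \<dots> + g (n + 1 - p)\<close>
  equal to \<open>l + 1 - p\<close> for \<open>p \<in> A\<close> and to \<open>0\<close> otherwise, and for \<open>l \<le> n\<close> both intervals are empty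
  exactly when \<open>l = \<lfloor>n/2\<rfloor>\<close>. A label \<open>c \<in> A\<close> makes the lift nonzero at the identity.
\<close>

lemma adjacency_matrix_mult_vec:
  fixes f :: "'a \<Rightarrow> real"
  assumes "distinct vs"
  shows "adjacency_matrix vs E *\<^sub>v vec (length vs) (\<lambda>i. f (vs ! i))
    = vec (length vs) (\<lambda>i. \<Sum>y | y \<in> set vs \<and> {vs ! i, y} \<in> E. f y)" (is "?A *\<^sub>v ?v = ?w")
proof (rule eq_vecI)
  fix i assume "i < dim_vec ?w"
  then have i: "i < length vs" by simp
  have "(?A *\<^sub>v ?v) $ i = (\<Sum>j<length vs. if {vs ! i, vs ! j} \<in> E then f (vs ! j) else 0)"
    using i by (auto simp: scalar_prod_def adjacency_matrix_def lessThan_atLeast0 intro!: sum.cong)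
  also have "\<dots> = (\<Sum>y\<in>set vs. if {vs ! i, y} \<in> E then f y else 0)"
    by (rule sum.reindex_bij_betw[OF bij_betw_nth[OF assms refl refl]])
  also have "\<dots> = ?w $ i"
    using i by (simp add: sum.inter_filter)
  finally show "(?A *\<^sub>v ?v) $ i = ?w $ i" .
qed (simp add: adjacency_matrix_def)

lemma eigenvalue_adjacency_matrixI:
  fixes f :: "'a \<Rightarrow> real"
  assumes "distinct vs" and "x \<in> set vs" and "f x \<noteq> 0"
    and eigenfunction: "\<And>x. x \<in> set vs \<Longrightarrow> (\<Sum>y | y \<in> set vs \<and> {x, y} \<in> E. f y) = ev * f x"
  shows "eigenvalue (adjacency_matrix vs E) ev"
proof -
  let ?v = "vec (length vs) (\<lambda>i. f (vs ! i))"
  obtain i where "i < length vs" "vs ! i = x"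
    using \<open>x \<in> set vs\<close> by (auto simp: in_set_conv_nth)
  then have "?v $ i \<noteq> 0\<^sub>v (length vs) $ i"
    using \<open>f x \<noteq> 0\<close> by simp
  then have "?v \<noteq> 0\<^sub>v (length vs)"
    by metis
  moreover have "adjacency_matrix vs E *\<^sub>v ?v = ev \<cdot>\<^sub>v ?v"
    unfolding adjacency_matrix_mult_vec[OF \<open>distinct vs\<close>] by (auto simp: eigenfunction)
  ultimately have "eigenvector (adjacency_matrix vs E) ?v ev"
    by (simp add: eigenvector_def adjacency_matrix_def)
  then show ?thesis
    unfolding eigenvalue_def by blast
qed

lemma hyperoctahedral_permutes: "\<sigma> \<in> hyperoctahedral n \<Longrightarrow> \<sigma> permutes pm_interval n"
  by (simp add: hyperoctahedral_def)

lemma id_in_hyperoctahedral: "id \<in> hyperoctahedral n"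
  by (simp add: hyperoctahedral_def permutes_id)

lemma neighbours_burnt_pancake:
  assumes "\<sigma> \<in> hyperoctahedral n"
  shows "{\<tau>. \<tau> \<in> hyperoctahedral n \<and> {\<sigma>, \<tau>} \<in> burnt_pancake_edges n}
    = (\<lambda>i. prefix_reversal i \<sigma>) ` {1..n}" (is "?neighbours = ?reversals")
proof
  show "?neighbours \<subseteq> ?reversals"
  proof
    fix \<tau> assume "\<tau> \<in> ?neighbours"
    then obtain \<rho> i where "i \<in> {1..n}" "\<rho> \<in> hyperoctahedral n"
      and "{\<sigma>, \<tau>} = {\<rho>, prefix_reversal i \<rho>}"
      by (auto simp: burnt_pancake_edges_def)
    then have "\<tau> = prefix_reversal i \<sigma>"
      using prefix_reversal_involution by (metis doubleton_eq_iff)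
    then show "\<tau> \<in> ?reversals"
      using \<open>i \<in> {1..n}\<close> by blast
  qed
  show "?reversals \<subseteq> ?neighbours"
    using assms prefix_reversal_closed unfolding burnt_pancake_edges_def by blast
qed

lemma inj_on_prefix_reversal:
  assumes "\<sigma> \<in> hyperoctahedral n"
  shows "inj_on (\<lambda>i. prefix_reversal i \<sigma>) {1..}"
proof (rule inj_onI)
  fix i j :: nat assume "i \<in> {1..}" "j \<in> {1..}"
    and "prefix_reversal i \<sigma> = prefix_reversal j \<sigma>"
  then have "\<sigma> (int i) = \<sigma> (int j)"
    by (auto simp: prefix_reversal_def dest: fun_cong[where x = 1])
  then show "i = j"
    using permutes_inj[OF hyperoctahedral_permutes[OF assms]] by (simp add: inj_eq)
qed

lemma sum_neighbours_burnt_pancake: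
  assumes "\<sigma> \<in> hyperoctahedral n"
  shows "(\<Sum>\<tau> | \<tau> \<in> hyperoctahedral n \<and> {\<sigma>, \<tau>} \<in> burnt_pancake_edges n. f \<tau>)
    = (\<Sum>i=1..n. f (prefix_reversal i \<sigma>))"
proof -
  have "inj_on (\<lambda>i. prefix_reversal i \<sigma>) {1..n}"
    using inj_on_prefix_reversal[OF assms] by (rule inj_on_subset) auto
  then show ?thesis
    unfolding neighbours_burnt_pancake[OF assms] by (simp add: sum.reindex)
qed

definition position :: "nat \<Rightarrow> (int \<Rightarrow> int) \<Rightarrow> nat" where
  "position c \<sigma> = nat \<bar>inv_into UNIV \<sigma> (int c)\<bar>"

lemma position_eq_iff:
  assumes "\<sigma> \<in> hyperoctahedral n"
  shows "position c \<sigma> = p \<longleftrightarrow> \<bar>\<sigma> (int p)\<bar> = int c"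
proof -
  have inv_eq_iff: "inv_into UNIV \<sigma> (int c) = j \<longleftrightarrow> \<sigma> j = int c" for j
    using bij_inv_eq_iff[OF permutes_bij[OF hyperoctahedral_permutes[OF assms]]] by metis
  have "position c \<sigma> = p \<longleftrightarrow> inv_into UNIV \<sigma> (int c) = int p \<or> inv_into UNIV \<sigma> (int c) = - int p"
    unfolding position_def by linarith
  also have "\<dots> \<longleftrightarrow> \<sigma> (int p) = int c \<or> - \<sigma> (int p) = int c"
    unfolding inv_eq_iff hyperoctahedral_odd[OF assms] ..
  also have "\<dots> \<longleftrightarrow> \<bar>\<sigma> (int p)\<bar> = int c"
    by linarith
  finally show ?thesis .
qed

lemma position_id: "position c id = c"
  by (simp add: position_def)

lemma position_in_range:
  assumes "\<sigma> \<in> hyperoctahedral n" and "c \<in> {1..n}"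
  shows "position c \<sigma> \<in> {1..n}"
proof -
  have "inv_into UNIV \<sigma> (int c) \<in> pm_interval n \<longleftrightarrow> int c \<in> pm_interval n"
    by (intro permutes_in_image permutes_inv hyperoctahedral_permutes assms(1))
  then show ?thesis
    using \<open>c \<in> {1..n}\<close> by (auto simp: position_def pm_interval_def)
qed

definition reverse_position :: "nat \<Rightarrow> nat \<Rightarrow> nat" where
  "reverse_position i p = (if p \<le> i then i + 1 - p else p)"

lemma position_prefix_reversal:
  assumes "\<sigma> \<in> hyperoctahedral n" and "c \<in> {1..n}" and "i \<in> {1..n}"
  shows "position c (prefix_reversal i \<sigma>) = reverse_position i (position c \<sigma>)"
proof -
  have "position c \<sigma> \<ge> 1"
    using position_in_range[OF assms(1,2)] by simp
  moreover have "\<bar>\<sigma> (int (position c \<sigma>))\<bar> = int c"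
    using position_eq_iff[OF assms(1)] by blast
  ultimately have "\<bar>prefix_reversal i \<sigma> (int (reverse_position i (position c \<sigma>)))\<bar> = int c"
    by (auto simp: prefix_reversal_def reverse_position_def of_nat_diff)
  then show ?thesis
    using position_eq_iff[OF prefix_reversal_closed[OF assms(1,3)]] by blast
qed

definition position_operator :: "nat \<Rightarrow> (nat \<Rightarrow> 'a) \<Rightarrow> nat \<Rightarrow> 'a::comm_monoid_add" where
  "position_operator n g p = (\<Sum>i=1..n. g (reverse_position i p))"

lemma position_operator_eq:
  fixes g :: "nat \<Rightarrow> 'a::semiring_1"
  assumes "p \<in> {1..n}"
  shows "position_operator n g p = of_nat (p - 1) * g p + (\<Sum>m=1..n + 1 - p. g m)"
proof -
  have "{1..n} = {1..<p} \<union> {p..n}"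
    using assms by auto
  then have "position_operator n g p = (\<Sum>i=1..<p. g p) + (\<Sum>i=p..n. g (i + 1 - p))"
    by (auto simp: position_operator_def reverse_position_def sum.union_disjoint ivl_disj_int)
  also have "(\<Sum>i=p..n. g (i + 1 - p)) = (\<Sum>m=1..n + 1 - p. g m)"
    by (rule sum.reindex_bij_witness[of _ "\<lambda>m. m + p - 1" "\<lambda>i. i + 1 - p"]) (use assms in auto)
  finally show ?thesis by simp
qed

lemma eigenvalue_burnt_pancakeI:
  fixes g :: "nat \<Rightarrow> real"
  assumes "distinct vs" and vertices: "set vs = hyperoctahedral n"
    and c: "c \<in> {1..n}" and "g c \<noteq> 0"
    and eigenfunction: "\<And>p. p \<in> {1..n} \<Longrightarrow> position_operator n g p = ev * g p"
  shows "eigenvalue (adjacency_matrix vs (burnt_pancake_edges n)) ev"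
proof (rule eigenvalue_adjacency_matrixI[where f = "\<lambda>\<sigma>. g (position c \<sigma>)" and x = id])
  show "id \<in> set vs"
    by (simp add: vertices id_in_hyperoctahedral)
  show "g (position c id) \<noteq> 0"
    using \<open>g c \<noteq> 0\<close> by (simp add: position_id)
next
  fix \<sigma> assume "\<sigma> \<in> set vs"
  then have \<sigma>: "\<sigma> \<in> hyperoctahedral n"
    by (simp add: vertices)
  have "(\<Sum>\<tau> | \<tau> \<in> set vs \<and> {\<sigma>, \<tau>} \<in> burnt_pancake_edges n. g (position c \<tau>))
    = (\<Sum>i=1..n. g (position c (prefix_reversal i \<sigma>)))"
    unfolding vertices by (rule sum_neighbours_burnt_pancake[OF \<sigma>])
  also have "\<dots> = position_operator n g (position c \<sigma>)"
    by (simp add: position_operator_def position_prefix_reversal[OF \<sigma> c])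
  also have "\<dots> = ev * g (position c \<sigma>)"
    by (rule eigenfunction[OF position_in_range[OF \<sigma> c]])
  finally show "(\<Sum>\<tau> | \<tau> \<in> set vs \<and> {\<sigma>, \<tau>} \<in> burnt_pancake_edges n. g (position c \<tau>))
    = ev * g (position c \<sigma>)" .
qed fact

definition balanced_indicator :: "'a set \<Rightarrow> 'a \<Rightarrow> 'a \<Rightarrow> 'b::ring_1" where
  "balanced_indicator A a x = of_bool (x \<in> A) - of_nat (card A) * of_bool (x = a)"

lemma sum_balanced_indicator:
  assumes "finite B"
  shows "(\<Sum>x\<in>B. balanced_indicator A a x :: 'b::ring_1)
    = of_nat (card (A \<inter> B)) - of_nat (card A) * of_bool (a \<in> B)"
proof -
  have "(\<Sum>x\<in>B. of_bool (x \<in> A) :: 'b) = of_nat (card (A \<inter> B))"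
    using assms by (simp add: Int_commute)
  moreover have "(\<Sum>x\<in>B. of_bool (x = a) :: 'b) = of_bool (a \<in> B)"
    using assms by (simp add: of_bool_def)
  ultimately show ?thesis
    by (simp add: balanced_indicator_def sum_subtractf flip: sum_distrib_left)
qed

lemma balanced_indicator_eigenfunction:
  fixes A :: "nat set" and l :: nat
  defines "g \<equiv> balanced_indicator A (l + 1) :: nat \<Rightarrow> 'a::ring_1"
  assumes p: "p \<in> {1..n}" and "l + 1 \<notin> A"
    and prefix_sum: "(\<Sum>m=1..n + 1 - p. g m) = (of_nat (l + 1) - of_nat p) * of_bool (p \<in> A)"
  shows "position_operator n g p = of_nat l * g p"
proof -
  have image: "position_operator n g p
    = of_nat (p - 1) * g p + (of_nat (l + 1) - of_nat p) * of_bool (p \<in> A)"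
    by (simp only: position_operator_eq[OF p] prefix_sum)
  consider (plateau) "p \<in> A" "p \<noteq> l + 1" | (correction) "p \<notin> A" "p = l + 1"
    | (outside) "p \<notin> A" "p \<noteq> l + 1"
    using \<open>l + 1 \<notin> A\<close> by blast
  then show ?thesis
  proof cases
    case plateau
    then have "g p = 1"
      by (simp add: g_def balanced_indicator_def)
    then show ?thesis
      using plateau p unfolding image by (simp add: of_nat_diff)
  next
    case correction
    then show ?thesis
      unfolding image by simp
  next
    case outside
    then have "g p = 0"
      by (simp add: g_def balanced_indicator_def)
    then show ?thesis
      using outside unfolding image by simp
  qed
qed

lemma prefix_sum_balanced_indicator_upper:
  fixes n l p :: nat
  defines "A \<equiv> {n - l + 1..l}"
  assumes "l \<le> n" and p: "p \<in> {1..n}"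
  shows "(\<Sum>m=1..n + 1 - p. balanced_indicator A (l + 1) m :: 'a::ring_1)
    = (of_nat (l + 1) - of_nat p) * of_bool (p \<in> A)"
proof -
  consider (before) "p \<le> n - l" "p \<notin> A" | (inside) "p \<in> A" | (after) "n - l < p" "l < p" "p \<notin> A"
    unfolding A_def by force
  then show ?thesis
  proof cases
    case before
    then have "l + 1 \<le> n + 1 - p"
      using \<open>l \<le> n\<close> by linarith
    moreover from this have "A \<inter> {1..n + 1 - p} = A"
      unfolding A_def by auto
    ultimately show ?thesis
      using before by (simp add: sum_balanced_indicator)
  next
    case inside
    then have "n + 1 - p \<le> l" "p \<le> l"
      using p unfolding A_def by auto
    moreover from this have "A \<inter> {1..n + 1 - p} = {n - l + 1..n + 1 - p}"
      unfolding A_def by auto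
    moreover have "n + 1 - p - (n - l) = l + 1 - p"
      using \<open>l \<le> n\<close> \<open>p \<le> l\<close> by linarith
    ultimately show ?thesis
      using inside by (simp add: sum_balanced_indicator of_nat_diff)
  next
    case after
    then have "n + 1 - p \<le> n - l" "n + 1 - p \<le> l"
      using \<open>l \<le> n\<close> by linarith+
    moreover from this have "A \<inter> {1..n + 1 - p} = {}"
      unfolding A_def by auto
    ultimately show ?thesis
      using after by (simp add: sum_balanced_indicator)
  qed
qed

lemma prefix_sum_balanced_indicator_lower:
  fixes n l p :: nat
  defines "A \<equiv> {l + 2..n - l}"
  assumes "l \<le> n" and p: "p \<in> {1..n}"
  shows "(\<Sum>m=1..n + 1 - p. balanced_indicator A (l + 1) m :: 'a::ring_1)
    = (of_nat (l + 1) - of_nat p) * of_bool (p \<in> A)"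
proof -
  consider (before) "p \<le> l + 1" "p \<notin> A" | (inside) "p \<in> A" | (after) "n - l < p" "p \<notin> A"
    unfolding A_def by force
  then show ?thesis
  proof cases
    case before
    then have "n - l \<le> n + 1 - p"
      by linarith
    then have "A \<inter> {1..n + 1 - p} = A" "A = {} \<or> l + 1 \<le> n + 1 - p"
      unfolding A_def by auto
    then show ?thesis
      using before by (auto simp: sum_balanced_indicator)
  next
    case inside
    then have "n + 1 - p \<le> n - l" "l + 1 \<le> n + 1 - p"
      using p unfolding A_def by auto
    moreover from this have "A \<inter> {1..n + 1 - p} = {l + 2..n + 1 - p}"
      unfolding A_def by auto
    moreover have "card A = card {l + 2..n + 1 - p} + (p - (l + 1))"
      using inside p unfolding A_def by auto
    ultimately show ?thesis
      using inside by (simp add: sum_balanced_indicator)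
  next
    case after
    then have "n + 1 - p \<le> l"
      using \<open>l \<le> n\<close> by linarith
    moreover from this have "A \<inter> {1..n + 1 - p} = {}"
      unfolding A_def by auto
    ultimately show ?thesis
      using after by (simp add: sum_balanced_indicator)
  qed
qed

lemma eigenvalue_burnt_pancake_balanced_indicator:
  fixes A :: "nat set"
  assumes "distinct vs" and "set vs = hyperoctahedral n"
    and "A \<subseteq> {1..n}" and "A \<noteq> {}" and "l + 1 \<notin> A"
    and prefix_sum: "\<And>p. p \<in> {1..n} \<Longrightarrow>
      (\<Sum>m=1..n + 1 - p. balanced_indicator A (l + 1) m :: real)
        = (of_nat (l + 1) - of_nat p) * of_bool (p \<in> A)"
  shows "eigenvalue (adjacency_matrix vs (burnt_pancake_edges n)) (real l)"
proof -
  obtain c where "c \<in> A"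
    using \<open>A \<noteq> {}\<close> by blast
  show ?thesis
  proof (rule eigenvalue_burnt_pancakeI[OF assms(1,2)])
    show "c \<in> {1..n}"
      using \<open>c \<in> A\<close> \<open>A \<subseteq> {1..n}\<close> by blast
    show "balanced_indicator A (l + 1) c \<noteq> (0 :: real)"
      using \<open>c \<in> A\<close> \<open>l + 1 \<notin> A\<close> by (auto simp: balanced_indicator_def)
  next
    fix p assume p: "p \<in> {1..n}"
    show "position_operator n (balanced_indicator A (l + 1)) p
      = real l * balanced_indicator A (l + 1) p"
      by (rule balanced_indicator_eigenfunction[OF p \<open>l + 1 \<notin> A\<close> prefix_sum[OF p]])
  qed
qed

theorem theorem5:
  fixes n :: nat and k :: int and vs :: "(int \<Rightarrow> int) list"
  assumes "n > 0"
    and "distinct vs" and "set vs = hyperoctahedral n"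
    and "k \<in> {0..int n} - {\<lfloor>real n / 2\<rfloor>}"
  shows "eigenvalue (adjacency_matrix vs (burnt_pancake_edges n)) (of_int k)"
proof -
  obtain l where k: "k = int l"
    using assms(4) nonneg_int_cases by auto
  have "\<lfloor>real n / 2\<rfloor> = int (n div 2)"
    using floor_divide_of_nat_eq[of n 2] by simp
  then consider (lower) "2 * l + 2 \<le> n" | (upper) "n < 2 * l" "l \<le> n"
    using assms(4) k by fastforce
  then have "eigenvalue (adjacency_matrix vs (burnt_pancake_edges n)) (real l)"
  proof cases
    case lower
    then show ?thesis
      by (intro eigenvalue_burnt_pancake_balanced_indicator[OF assms(2,3) _ _ _
            prefix_sum_balanced_indicator_lower]) auto
  next
    case upper
    then show ?thesis
      by (intro eigenvalue_burnt_pancake_balanced_indicator[OF assms(2,3) _ _ _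
            prefix_sum_balanced_indicator_upper]) auto
  qed
  then show ?thesis
    by (simp add: k)
qed

end
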